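(* Let $A \in \mathbb{R}^{n\times n}$, $b, x_0 \in \mathbb{R}^n$ with $r_0 = b - A x_0 \neq 0$, and let $M : \mathbb{R}^n \to \mathbb{R}^n$ be an arbitrary (possibly nonlinear) operator. Assume that FGMRES with preconditioner $M$ is run on $Ax=b$ from the initial guess $x_0$, without restart and without breakdown, until completion (that is, for $n$ steps), and let $H_n = [h_{ij}]\in\mathbb{R}^{n\times n}$ be the resulting upper Hessenberg matrix. Suppose $H_n$ is diagonalizable, i.e. there is an invertible $Y\in\mathbb{C}^{n\times n}$ with $$Y^{-1} H_n Y = \Sigma = \operatorname{diag}(\sigma_1,\ldots,\sigma_n).$$ Then the residuals $r_m = b - A x_m$ satisfy $$\| r_m \|_2 \le \kappa_2(Y)\, \epsilon^{(m)}(\Sigma)\, \| r_0 \|_2 \qquad \text{for all } m = 1,\ldots,n,$$ where $$\epsilon^{(m)}(\Sigma) = \min_{p \in \mathbb{P}_m,\; p(0)=1}\ \max_{i=1,\ldots,n} |p(\sigma_i)| .$$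
   Context: FGMRES (flexible GMRES) without restart with operator $M:\mathbb{R}^n\to\mathbb{R}^n$ (not necessarily linear) is the following procedure (exact arithmetic). Set $r_0 = b - A x_0$, $\beta = \|r_0\|_2$, $v_1 = r_0/\beta$. For $j = 1,2,\ldots,n$: compute $z_j = M(v_j)$ and $w = A z_j$; for $i=1,\ldots,j$ set $h_{ij} = w^\top v_i$ and replace $w$ by $w - h_{ij} v_i$; then set $h_{j+1,j} = \|w\|_2$ and $v_{j+1} = w/h_{j+1,j}$. All other $h_{ij}$ are zero. For each $m$ let $Z_m = [z_1,\ldots,z_m] \in \mathbb{R}^{n\times m}$, $H_m = [h_{ij}]_{1\le i,j\le m}\in\mathbb{R}^{m\times m}$ (upper Hessenberg), and $\overline{H}_m = [h_{ij}] \in \mathbb{R}^{(m+1)\times m}$ (which extends $H_m$ by one additional row at the bottom). The approximate solution after $m$ steps is $x_m = x_0 + Z_m y_m$, where $y_m$ minimizes $\|\beta e_1 - \overline{H}_m y\|_2$ over $y\in\mathbb{R}^m$; equivalently, $y_m$ minimizes $\|r_0 - A Z_m y\|_2$. "Without breakdown" means that $h_{j+1,j} \neq 0$ for all $j < n$. (At step $j=n$, necessarily $w=0$ and $h_{n+1,n}=0$ because $v_1,\ldots,v_n$ is an orthonormal basis of $\mathbb{R}^n$; this is completion, not breakdown, and $v_{n+1}$ is not needed.) $\kappa_2(Y) = \|Y\|_2\|Y^{-1}\|_2$ is the 2-norm condition number, and $\mathbb{P}_m$ is the space of polynomials of degree at most $m$ (complex coefficients). *)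

theory Defs
  imports "HOL-Analysis.Analysis" "HOL-Computational_Algebra.Polynomial"
begin

section \<open>Flexible GMRES\<close>

text \<open>
  Everything produced by the algorithm is indexed from 1. Vectors of \<^typ>\<open>real ^ 'n\<close> play
  the role of elements of R^n with n = CARD('n), whereas the index of the basis vectors,
  of the rows and columns of the Hessenberg matrix and of the coefficient vectors
  is a natural number.
\<close>

text \<open>\<open>mgs v w i\<close> is the value of the variable \<open>w\<close> of the modified Gram-Schmidt loop
  after its passes \<open>1, ..., i\<close>.\<close>

primrec mgs :: "(nat \<Rightarrow> 'a::real_inner) \<Rightarrow> 'a \<Rightarrow> nat \<Rightarrow> 'a" where
  "mgs v w 0 = w"
| "mgs v w (Suc i) = mgs v w i - (mgs v w i \<bullet> v (Suc i)) *\<^sub>R v (Suc i)"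

text \<open>\<open>fgmres_basis A M r0 j\<close> is the sequence of basis vectors after \<open>j\<close> steps; only its
  entries \<open>1, ..., j + 1\<close> have been filled in. A zero vector is normalised
  to zero; this only happens for \<open>r0 = 0\<close>, on breakdown or on completion.\<close>

primrec fgmres_basis ::
  "real^'n^'n \<Rightarrow> (real^'n \<Rightarrow> real^'n) \<Rightarrow> real^'n \<Rightarrow> nat \<Rightarrow> (nat \<Rightarrow> real^'n)" where
  "fgmres_basis A M r0 0 = (\<lambda>_. 0)(1 := r0 /\<^sub>R norm r0)"
| "fgmres_basis A M r0 (Suc j) =
    (let v = fgmres_basis A M r0 j;
         w = mgs v (A *v M (v (j + 1))) (j + 1)
     in v(j + 2 := w /\<^sub>R norm w))"

definition fgmres_v ::
  "real^'n^'n \<Rightarrow> (real^'n \<Rightarrow> real^'n) \<Rightarrow> real^'n \<Rightarrow> nat \<Rightarrow> real^'n" where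
  "fgmres_v A M r0 j = fgmres_basis A M r0 j j"

definition fgmres_z ::
  "real^'n^'n \<Rightarrow> (real^'n \<Rightarrow> real^'n) \<Rightarrow> real^'n \<Rightarrow> nat \<Rightarrow> real^'n" where
  "fgmres_z A M r0 j = M (fgmres_v A M r0 j)"

text \<open>\<open>fgmres_w A M r0 j i\<close> is the vector \<open>w\<close> of step \<open>j\<close> after \<open>i\<close> orthogonalisations.\<close>

definition fgmres_w ::
  "real^'n^'n \<Rightarrow> (real^'n \<Rightarrow> real^'n) \<Rightarrow> real^'n \<Rightarrow> nat \<Rightarrow> nat \<Rightarrow> real^'n" where
  "fgmres_w A M r0 j i = mgs (fgmres_v A M r0) (A *v fgmres_z A M r0 j) i"

definition fgmres_h ::
  "real^'n^'n \<Rightarrow> (real^'n \<Rightarrow> real^'n) \<Rightarrow> real^'n \<Rightarrow> nat \<Rightarrow> nat \<Rightarrow> real" where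
  "fgmres_h A M r0 i j =
    (if 1 \<le> i \<and> i \<le> j then fgmres_w A M r0 j (i - 1) \<bullet> fgmres_v A M r0 i
     else if 1 \<le> j \<and> i = j + 1 then norm (fgmres_w A M r0 j j)
     else 0)"

definition fgmres_no_breakdown ::
  "real^'n^'n \<Rightarrow> (real^'n \<Rightarrow> real^'n) \<Rightarrow> real^'n \<Rightarrow> bool" where
  "fgmres_no_breakdown A M r0 \<longleftrightarrow> (\<forall>j\<in>{1..<CARD('n)}. fgmres_h A M r0 (j + 1) j \<noteq> 0)"

text \<open>The 2-norm of \<open>\<beta> e\<^sub>1 - H y\<close>, where \<open>H\<close> is the extended Hessenberg matrix
  with \<open>m + 1\<close> rows and \<open>m\<close> columns; only the entries \<open>1, ..., m\<close> of \<open>y\<close> matter.\<close>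

definition fgmres_lsq ::
  "real^'n^'n \<Rightarrow> (real^'n \<Rightarrow> real^'n) \<Rightarrow> real^'n \<Rightarrow> nat \<Rightarrow> (nat \<Rightarrow> real) \<Rightarrow> real" where
  "fgmres_lsq A M r0 m y =
    L2_set (\<lambda>i. (if i = 1 then norm r0 else 0) - (\<Sum>j=1..m. fgmres_h A M r0 i j * y j)) {1..m+1}"

text \<open>A relation rather than a function: the least squares problem of the
  last step may have several minimizers.\<close>

definition fgmres_iterate ::
  "real^'n^'n \<Rightarrow> real^'n \<Rightarrow> (real^'n \<Rightarrow> real^'n) \<Rightarrow> real^'n \<Rightarrow> nat \<Rightarrow> real^'n \<Rightarrow> bool" where
  "fgmres_iterate A b M x0 m x \<longleftrightarrow>
    (let r0 = b - A *v x0 in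
      \<exists>y. (\<forall>y'. fgmres_lsq A M r0 m y \<le> fgmres_lsq A M r0 m y') \<and>
          x = x0 + (\<Sum>j=1..m. y j *\<^sub>R fgmres_z A M r0 j))"

text \<open>The square Hessenberg matrix of the completed run, regarded as a complex
  matrix; the bijection \<open>idx\<close> numbers the elements of the index type by \<open>1, ..., CARD('n)\<close>.\<close>

definition fgmres_H ::
  "('n \<Rightarrow> nat) \<Rightarrow> real^'n^'n \<Rightarrow> (real^'n \<Rightarrow> real^'n) \<Rightarrow> real^'n \<Rightarrow> complex^'n^'n" where
  "fgmres_H idx A M r0 = (\<chi> i j. complex_of_real (fgmres_h A M r0 (idx i) (idx j)))"

section \<open>Diagonal matrices, condition number and polynomial approximation\<close>

definition diag_matrix :: "('n \<Rightarrow> complex) \<Rightarrow> complex^'n^'n" where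
  "diag_matrix \<sigma> = (\<chi> i j. if i = j then \<sigma> i else 0)"

definition cond2 :: "complex^'n^'n \<Rightarrow> real" where
  "cond2 Y = onorm ((*v) Y) * onorm ((*v) (matrix_inv Y))"

text \<open>The infimum is a minimum, see \<open>poly_eps_attained\<close> below.\<close>

definition poly_eps :: "nat \<Rightarrow> ('n::finite \<Rightarrow> complex) \<Rightarrow> real" where
  "poly_eps m \<sigma> =
    (INF p\<in>{p. degree p \<le> m \<and> poly p 0 = 1}. MAX i\<in>UNIV. cmod (poly p (\<sigma> i)))"

lemma continuous_on_Max:
  fixes f :: "'i \<Rightarrow> 'a::topological_space \<Rightarrow> real"
  assumes "finite I" "I \<noteq> {}" "\<And>i. i \<in> I \<Longrightarrow> continuous_on S (f i)"
  shows "continuous_on S (\<lambda>x. MAX i\<in>I. f i x)"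
  using assms
proof (induction I rule: finite_ne_induct)
  case (insert a F)
  then show ?case by (simp add: continuous_on_max)
qed simp

lemma poly_eps_attained:
  fixes \<sigma> :: "'n::finite \<Rightarrow> complex"
  obtains p where "degree p \<le> m" "poly p 0 = 1"
    "poly_eps m \<sigma> = (MAX i\<in>UNIV. cmod (poly p (\<sigma> i)))"
    "\<And>q. degree q \<le> m \<Longrightarrow> poly q 0 = 1 \<Longrightarrow>
      poly_eps m \<sigma> \<le> (MAX i\<in>UNIV. cmod (poly q (\<sigma> i)))"
proof -
  define P :: "complex poly set" where "P = {p. degree p \<le> m \<and> poly p 0 = 1}"
  define F :: "complex^'n \<Rightarrow> real" where "F x = (MAX i\<in>UNIV. cmod (x $ i))" for x
  define ev :: "complex poly \<Rightarrow> complex^'n" where "ev p = (\<chi> i. poly p (\<sigma> i))" for p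
  define L where "L = ev ` {p. degree p \<le> m \<and> poly p 0 = 0}"
  define S where "S = ev ` P"
  have F_ev: "F (ev p) = (MAX i\<in>UNIV. cmod (poly p (\<sigma> i)))" for p
    by (simp add: F_def ev_def)
  have one: "1 \<in> P" by (simp add: P_def)
  have F_ge: "cmod (x $ i) \<le> F x" for x i
    unfolding F_def by (rule Max_ge) auto
  have "subspace L"
    unfolding L_def subspace_def
  proof (intro conjI ballI allI)
    show "0 \<in> ev ` {p. degree p \<le> m \<and> poly p 0 = 0}"
      by (rule image_eqI[of _ _ 0]) (auto simp: ev_def vec_eq_iff)
  next
    fix x y
    assume "x \<in> ev ` {p. degree p \<le> m \<and> poly p 0 = 0}" "y \<in> ev ` {p. degree p \<le> m \<and> poly p 0 = 0}"
    then obtain p q where "x = ev p" "y = ev q" "degree p \<le> m" "degree q \<le> m"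
      "poly p 0 = 0" "poly q 0 = 0" by auto
    then show "x + y \<in> ev ` {p. degree p \<le> m \<and> poly p 0 = 0}"
      by (intro image_eqI[of _ _ "p + q"]) (auto simp: ev_def vec_eq_iff intro: degree_add_le)
  next
    fix c :: real and x
    assume "x \<in> ev ` {p. degree p \<le> m \<and> poly p 0 = 0}"
    then obtain p where "x = ev p" "degree p \<le> m" "poly p 0 = 0" by auto
    then show "c *\<^sub>R x \<in> ev ` {p. degree p \<le> m \<and> poly p 0 = 0}"
      by (intro image_eqI[of _ _ "smult (of_real c) p"])
        (auto simp: ev_def vec_eq_iff scaleR_conv_of_real[where 'a=complex] intro: order_trans[OF degree_smult_le])
  qed
  then have "closed L" by (rule closed_subspace)
  moreover have "S = (+) (ev 1) ` L"
  proof (intro set_eqI iffI)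
    fix x assume "x \<in> S"
    then obtain p where p: "x = ev p" "degree p \<le> m" "poly p 0 = 1" by (auto simp: S_def P_def)
    then have "x = ev 1 + ev (p - 1)" by (simp add: ev_def vec_eq_iff)
    moreover have "ev (p - 1) \<in> L"
      using p unfolding L_def by (intro imageI) (auto intro: degree_diff_le)
    ultimately show "x \<in> (+) (ev 1) ` L" by blast
  next
    fix x assume "x \<in> (+) (ev 1) ` L"
    then obtain p where p: "x = ev 1 + ev p" "degree p \<le> m" "poly p 0 = 0" by (auto simp: L_def)
    then have "x = ev (1 + p)" by (simp add: ev_def vec_eq_iff)
    moreover have "1 + p \<in> P"
      using p by (auto simp: P_def intro: degree_add_le)
    ultimately show "x \<in> S" by (auto simp: S_def)
  qed
  ultimately have "closed S" by (simp add: closed_translation)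
  define K where "K = S \<inter> {x. F x \<le> F (ev 1)}"
  have cont: "continuous_on T F" for T
    unfolding F_def by (intro continuous_on_Max continuous_intros) auto
  have "closed {x. F x \<le> F (ev 1)}"
    by (intro closed_Collect_le cont continuous_intros)
  then have "closed K" using \<open>closed S\<close> by (auto simp: K_def)
  moreover have "bounded K"
  proof (rule boundedI)
    fix x assume "x \<in> K"
    have "norm x \<le> (\<Sum>i\<in>UNIV. cmod (x $ i))" unfolding norm_vec_def by (rule L2_set_le_sum) simp
    also have "\<dots> \<le> (\<Sum>i\<in>(UNIV::'n set). F x)" by (intro sum_mono F_ge)
    also have "\<dots> \<le> real CARD('n) * F (ev 1)"
      using \<open>x \<in> K\<close> by (simp add: K_def)
    finally show "norm x \<le> real CARD('n) * F (ev 1)" .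
  qed
  ultimately have "compact K" by (simp add: compact_eq_bounded_closed)
  moreover have "ev 1 \<in> K" using one by (simp add: K_def S_def)
  ultimately obtain x where x: "x \<in> K" "\<And>y. y \<in> K \<Longrightarrow> F x \<le> F y"
    using continuous_attains_inf[OF _ _ cont] by (metis empty_iff)
  then obtain p where p: "p \<in> P" "x = ev p" by (auto simp: K_def S_def)
  have le: "F (ev p) \<le> F (ev q)" if "q \<in> P" for q
  proof (cases "F (ev q) \<le> F (ev 1)")
    case True
    then show ?thesis using that x(2)[of "ev q"] p by (simp add: K_def S_def)
  next
    case False
    then show ?thesis using x(2)[OF \<open>ev 1 \<in> K\<close>] p by simp
  qed
  have "poly_eps m \<sigma> = Inf ((\<lambda>q. F (ev q)) ` P)"
    by (simp add: poly_eps_def P_def F_ev)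
  also have "\<dots> = F (ev p)"
    by (rule cInf_eq_minimum) (use p le in auto)
  finally have eq: "poly_eps m \<sigma> = F (ev p)" .
  show ?thesis
    by (rule that[of p]) (use p le eq in \<open>auto simp: P_def F_ev\<close>)
qed

end

theory Submission
  imports Defs
begin

text \<open>
  Every step of the procedure gives \<open>A z\<^sub>j = \<Sum>i\<le>j+1. h\<^sub>i\<^sub>j v\<^sub>i\<close>, where the \<open>v\<^sub>i\<close> are mutually
  orthogonal and of norm at most 1. So the residual of \<open>x0 + \<Sum>j\<le>m. y\<^sub>j z\<^sub>j\<close> is at most the
  least squares functional at \<open>y\<close> (\<open>norm_residual_le_lsq\<close>), and since the iterate minimizes that
  functional, it remains to exhibit one coefficient vector where its value is small.

  Let \<open>p\<close> attain \<open>\<epsilon>\<^sup>(\<^sup>m\<^sup>)(\<Sigma>)\<close> and write \<open>p(t) = 1 + t q(t)\<close> with \<open>q\<close> of degree less than \<open>m\<close>.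
  As \<open>H\<close> is Hessenberg, \<open>q(H) e\<^sub>1\<close> vanishes beyond its first \<open>m\<close> entries
  (\<open>diag_poly_apply_supported\<close>), so \<open>y = - \<beta> Re (q(H) e\<^sub>1)\<close> is admissible. Since \<open>H\<close> is real,
  \<open>\<beta> e\<^sub>1 - H y = \<beta> Re (p(H) e\<^sub>1)\<close>, and \<open>p(H) = Y p(\<Sigma>) Y\<^sup>-\<^sup>1\<close> bounds its norm by
  \<open>\<kappa>(Y) \<epsilon>\<^sup>(\<^sup>m\<^sup>)(\<Sigma>) \<beta>\<close> (\<open>norm_diag_poly_apply_le\<close>). For \<open>m = n\<close> the extended matrix has a row \<open>n + 1\<close>
  that \<open>H\<close> lacks; it vanishes because R^n has no \<open>n + 1\<close> nonzero orthogonal vectors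
  (\<open>fgmres_h_completion\<close>).
\<close>

section \<open>The modified Gram-Schmidt loop\<close>

lemma mgs_cong:
  assumes "\<And>k. 1 \<le> k \<Longrightarrow> k \<le> i \<Longrightarrow> v k = v' k"
  shows "mgs v w i = mgs v' w i"
  using assms by (induction i) auto

lemma mgs_decomp:
  "w = mgs v w i + (\<Sum>k=1..i. (mgs v w (k - 1) \<bullet> v k) *\<^sub>R v k)"
  by (induction i) (auto simp: algebra_simps)

text \<open>Zero vectors are allowed, since the procedure normalises zero to zero.\<close>

lemma mgs_orthogonal:
  assumes orth: "\<And>k l. k \<in> {1..j} \<Longrightarrow> l \<in> {1..j} \<Longrightarrow> k \<noteq> l \<Longrightarrow> v k \<bullet> v l = 0"
    and unit: "\<And>k. k \<in> {1..j} \<Longrightarrow> v k = 0 \<or> norm (v k) = 1"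
    and "i \<le> j" "k \<in> {1..i}"
  shows "mgs v w i \<bullet> v k = 0"
  using assms(3,4)
proof (induction i)
  case (Suc i)
  show ?case
  proof (cases "k = Suc i")
    case True
    then show ?thesis
      using unit[of "Suc i"] Suc.prems by (auto simp: inner_diff_left norm_eq_1)
  next
    case False
    then have "mgs v w i \<bullet> v k = 0" "v (Suc i) \<bullet> v k = 0"
      using Suc orth by auto
    then show ?thesis by (simp add: inner_diff_left)
  qed
qed simp

section \<open>The basis and the Hessenberg matrix\<close>

lemma fgmres_basis_add:
  "j \<le> k + 1 \<Longrightarrow> fgmres_basis A M r0 (k + d) j = fgmres_basis A M r0 k j"
  by (induction d) (auto simp: Let_def)

lemma fgmres_basis_eq_v:
  assumes "j \<le> k + 1"
  shows "fgmres_basis A M r0 k j = fgmres_v A M r0 j"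
proof (cases "j \<le> k")
  case True
  then show ?thesis
    using fgmres_basis_add[of j j A M r0 "k - j"] by (simp add: fgmres_v_def)
next
  case False
  then have "j = k + 1" using assms by simp
  then show ?thesis
    using fgmres_basis_add[of j k A M r0 1] by (simp add: fgmres_v_def)
qed

lemma fgmres_v_1: "fgmres_v A M r0 1 = r0 /\<^sub>R norm r0"
  using fgmres_basis_eq_v[of 1 0 A M r0] by simp

lemma fgmres_v_Suc:
  assumes "1 \<le> j"
  shows "fgmres_v A M r0 (Suc j) = fgmres_w A M r0 j j /\<^sub>R norm (fgmres_w A M r0 j j)"
proof -
  obtain k where j: "j = Suc k" using assms by (cases j) auto
  have "mgs (fgmres_basis A M r0 k) w (Suc k) = mgs (fgmres_v A M r0) w (Suc k)" for w
    by (rule mgs_cong) (simp add: fgmres_basis_eq_v)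
  then have "fgmres_basis A M r0 (Suc k) (k + 2) =
      fgmres_w A M r0 j j /\<^sub>R norm (fgmres_w A M r0 j j)"
    by (simp add: Let_def j fgmres_w_def fgmres_z_def fgmres_basis_eq_v)
  then show ?thesis
    using fgmres_basis_eq_v[of "k + 2" "Suc k" A M r0] by (simp add: j)
qed

lemma norm_scaleR_normalised: "norm w *\<^sub>R (w /\<^sub>R norm w) = w"
  for w :: "'a::real_normed_vector"
  by (cases "w = 0") auto

lemma normalised_unit: "w /\<^sub>R norm w = 0 \<or> norm (w /\<^sub>R norm w) = 1"
  for w :: "'a::real_normed_vector"
  by (cases "w = 0") auto

lemma fgmres_v_unit:
  assumes "1 \<le> j"
  shows "fgmres_v A M r0 j = 0 \<or> norm (fgmres_v A M r0 j) = 1"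
proof (cases "j = 1")
  case True
  then show ?thesis using normalised_unit[of r0] by (simp only: fgmres_v_1)
next
  case False
  then obtain k where k: "j = Suc k" "1 \<le> k" using assms by (cases j) auto
  then show ?thesis
    using normalised_unit[of "fgmres_w A M r0 k k"] by (simp only: fgmres_v_Suc)
qed

lemma fgmres_v_orthogonal:
  assumes "1 \<le> i" "1 \<le> j" "i \<noteq> j"
  shows "fgmres_v A M r0 i \<bullet> fgmres_v A M r0 j = 0"
proof -
  have "\<forall>k\<in>{1..n}. \<forall>l\<in>{1..n}. k \<noteq> l \<longrightarrow> fgmres_v A M r0 k \<bullet> fgmres_v A M r0 l = 0" for n
  proof (induction n)
    case (Suc n)
    have new: "fgmres_v A M r0 (Suc n) \<bullet> fgmres_v A M r0 k = 0" if "k \<in> {1..n}" for k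
    proof -
      have "fgmres_w A M r0 n n \<bullet> fgmres_v A M r0 k = 0"
        unfolding fgmres_w_def
        by (rule mgs_orthogonal[where j = n])
          (use Suc that fgmres_v_unit[of _ A M r0] in \<open>simp_all del: One_nat_def\<close>)
      then show ?thesis using that by (simp add: fgmres_v_Suc)
    qed
    show ?case
      using Suc new by (auto simp: le_Suc_eq inner_commute)
  qed simp
  from this[of "max i j"] show ?thesis using assms by auto
qed

lemma fgmres_h_zero: "j + 1 < i \<Longrightarrow> fgmres_h A M r0 i j = 0"
  by (simp add: fgmres_h_def)

lemma fgmres_h_subdiag_eq_0_iff:
  assumes "1 \<le> j"
  shows "fgmres_h A M r0 (Suc j) j = 0 \<longleftrightarrow> fgmres_v A M r0 (Suc j) = 0"
  using assms by (simp add: fgmres_h_def fgmres_v_Suc)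

text \<open>This also holds for \<open>w = 0\<close>, where both \<open>h\<^sub>j\<^sub>+\<^sub>1\<^sub>,\<^sub>j\<close> and \<open>v\<^sub>j\<^sub>+\<^sub>1\<close> are zero.\<close>

lemma fgmres_arnoldi:
  assumes "1 \<le> j" "j \<le> m"
  shows "A *v fgmres_z A M r0 j = (\<Sum>i=1..m+1. fgmres_h A M r0 i j *\<^sub>R fgmres_v A M r0 i)"
proof -
  let ?v = "fgmres_v A M r0" and ?h = "fgmres_h A M r0" and ?w = "fgmres_w A M r0 j"
  have "A *v fgmres_z A M r0 j = ?w j + (\<Sum>i=1..j. (?w (i - 1) \<bullet> ?v i) *\<^sub>R ?v i)"
    unfolding fgmres_w_def by (rule mgs_decomp)
  also have "?w j = ?h (Suc j) j *\<^sub>R ?v (Suc j)"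
    using assms norm_scaleR_normalised[of "?w j"]
    by (simp add: fgmres_h_def fgmres_v_Suc del: scaleR_scaleR)
  also have "(\<Sum>i=1..j. (?w (i - 1) \<bullet> ?v i) *\<^sub>R ?v i) = (\<Sum>i=1..j. ?h i j *\<^sub>R ?v i)"
    by (rule sum.cong) (auto simp: fgmres_h_def)
  also have "?h (Suc j) j *\<^sub>R ?v (Suc j) + \<dots> = (\<Sum>i=1..Suc j. ?h i j *\<^sub>R ?v i)"
    by simp
  also have "\<dots> = (\<Sum>i=1..m+1. ?h i j *\<^sub>R ?v i)"
    by (rule sum.mono_neutral_left) (use assms in \<open>auto simp: fgmres_h_zero\<close>)
  finally show ?thesis .
qed

text \<open>Without breakdown, a nonzero entry in row \<open>n + 1\<close> would make \<open>v\<^sub>1, \<dots>, v\<^sub>n\<^sub>+\<^sub>1\<close> an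
  orthogonal family of \<open>n + 1\<close> nonzero vectors in a space of dimension \<open>n\<close>.\<close>

lemma fgmres_h_completion:
  fixes A :: "real^'n^'n"
  assumes "r0 \<noteq> 0" "fgmres_no_breakdown A M r0" "j \<le> CARD('n)"
  shows "fgmres_h A M r0 (CARD('n) + 1) j = 0"
proof (rule ccontr)
  let ?v = "fgmres_v A M r0" and ?I = "{1..CARD('n) + 1}"
  assume nz: "fgmres_h A M r0 (CARD('n) + 1) j \<noteq> 0"
  then have "j = CARD('n)"
    using assms(3) fgmres_h_zero[of j "CARD('n) + 1" A M r0] by (cases "j = CARD('n)") auto
  have v_nz: "?v i \<noteq> 0" if "i \<in> ?I" for i
  proof (cases "i = 1")
    case True
    then show ?thesis using assms(1) fgmres_v_1[of A M r0] by auto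
  next
    case False
    then obtain k where k: "i = Suc k" "1 \<le> k" "k \<le> CARD('n)"
      using \<open>i \<in> ?I\<close> by (cases i) auto
    then have "fgmres_h A M r0 (Suc k) k \<noteq> 0"
      using nz \<open>j = CARD('n)\<close> assms(2)
      by (cases "k = CARD('n)") (auto simp: fgmres_no_breakdown_def)
    then show ?thesis using k fgmres_h_subdiag_eq_0_iff by metis
  qed
  have "inj_on ?v ?I"
  proof (rule inj_onI, rule ccontr)
    fix k l assume kl: "k \<in> ?I" "l \<in> ?I" "?v k = ?v l" "k \<noteq> l"
    then have "?v k \<bullet> ?v k = 0" using fgmres_v_orthogonal[of k l A M r0] by simp
    then show False using v_nz kl by simp
  qed
  then have "card (?v ` ?I) = CARD('n) + 1" by (simp add: card_image)
  moreover have "independent (?v ` ?I)"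
  proof (rule pairwise_orthogonal_independent)
    show "pairwise orthogonal (?v ` ?I)"
      unfolding pairwise_def orthogonal_def
    proof (intro ballI impI)
      fix x y assume "x \<in> ?v ` ?I" "y \<in> ?v ` ?I" "x \<noteq> y"
      then obtain k l where "x = ?v k" "y = ?v l" "k \<in> ?I" "l \<in> ?I" "k \<noteq> l" by blast
      then show "x \<bullet> y = 0" using fgmres_v_orthogonal[of k l A M r0] by simp
    qed
    show "0 \<notin> ?v ` ?I" using v_nz by (metis imageE)
  qed
  ultimately show False
    using independent_bound[of "?v ` ?I"] by simp
qed

section \<open>Residual and least squares functional\<close>

lemma norm_sum_orthogonal_le:
  assumes "finite I"
    and orth: "\<And>i j. i \<in> I \<Longrightarrow> j \<in> I \<Longrightarrow> i \<noteq> j \<Longrightarrow> v i \<bullet> v j = 0"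
    and unit: "\<And>i. i \<in> I \<Longrightarrow> norm (v i) \<le> 1"
  shows "norm (\<Sum>i\<in>I. c i *\<^sub>R v i) \<le> L2_set c I"
proof -
  have "(norm (\<Sum>i\<in>I. c i *\<^sub>R v i))\<^sup>2 = (\<Sum>i\<in>I. (norm (c i *\<^sub>R v i))\<^sup>2)"
    by (rule norm_sum_Pythagorean[OF \<open>finite I\<close>])
      (auto simp: pairwise_def orthogonal_def orth)
  also have "\<dots> \<le> (\<Sum>i\<in>I. (c i)\<^sup>2)"
  proof (rule sum_mono)
    fix i assume "i \<in> I"
    then have "norm (c i *\<^sub>R v i) \<le> \<bar>c i\<bar>"
      using mult_left_mono[OF unit, of i "\<bar>c i\<bar>"] by simp
    then show "(norm (c i *\<^sub>R v i))\<^sup>2 \<le> (c i)\<^sup>2"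
      by (metis norm_ge_zero power2_abs power_mono)
  qed
  finally show ?thesis
    unfolding L2_set_def by (rule real_le_rsqrt)
qed

text \<open>For \<open>r0 \<noteq> 0\<close> and without breakdown this is an equality for \<open>m \<le> n\<close>; the inequality always holds and
  spares the distinction between zero and unit basis vectors.\<close>

lemma norm_residual_le_lsq:
  "norm (r0 - A *v (\<Sum>j=1..m. y j *\<^sub>R fgmres_z A M r0 j)) \<le> fgmres_lsq A M r0 m y"
proof -
  let ?v = "fgmres_v A M r0" and ?h = "fgmres_h A M r0" and ?z = "fgmres_z A M r0"
  let ?e = "\<lambda>i. if i = 1 then norm r0 else 0"
  have "(\<Sum>i=1..m+1. ?e i *\<^sub>R ?v i) = (\<Sum>i=1..m+1. if i = 1 then norm r0 *\<^sub>R ?v 1 else 0)"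
    by (rule sum.cong) auto
  also have "\<dots> = norm r0 *\<^sub>R ?v 1" by simp
  also have "\<dots> = r0" by (simp only: fgmres_v_1 norm_scaleR_normalised)
  finally have r0: "(\<Sum>i=1..m+1. ?e i *\<^sub>R ?v i) = r0" .
  have "A *v (\<Sum>j=1..m. y j *\<^sub>R ?z j) = (\<Sum>j=1..m. y j *\<^sub>R (A *v ?z j))"
    by (simp add: linear_sum[OF matrix_vector_mul_linear] matrix_vector_mult_scaleR)
  also have "\<dots> = (\<Sum>j=1..m. y j *\<^sub>R (\<Sum>i=1..m+1. ?h i j *\<^sub>R ?v i))"
    by (rule sum.cong) (auto simp: fgmres_arnoldi)
  also have "\<dots> = (\<Sum>j=1..m. \<Sum>i=1..m+1. (?h i j * y j) *\<^sub>R ?v i)"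
    unfolding scaleR_right.sum by (simp add: mult.commute)
  also have "\<dots> = (\<Sum>i=1..m+1. (\<Sum>j=1..m. ?h i j * y j) *\<^sub>R ?v i)"
    unfolding scaleR_left.sum by (rule sum.swap)
  finally have "r0 - A *v (\<Sum>j=1..m. y j *\<^sub>R ?z j) =
      (\<Sum>i=1..m+1. (?e i - (\<Sum>j=1..m. ?h i j * y j)) *\<^sub>R ?v i)"
    unfolding scaleR_left_diff_distrib sum_subtractf r0 by simp
  also have "norm \<dots> \<le> fgmres_lsq A M r0 m y"
    unfolding fgmres_lsq_def
  proof (rule norm_sum_orthogonal_le)
    show "norm (?v i) \<le> 1" if "i \<in> {1..m+1}" for i
      using fgmres_v_unit[of i A M r0] that by auto
  qed (auto intro: fgmres_v_orthogonal)
  finally show ?thesis .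
qed

section \<open>Polynomials of a diagonalizable matrix\<close>

text \<open>The vector \<open>q(H) u\<close> for invertible \<open>Y\<close> and \<open>H = Y \<Sigma> Y\<^sup>-\<^sup>1\<close>, encoded as \<open>Y q(\<Sigma>) Y\<^sup>-\<^sup>1 u\<close> so that powers of a
  matrix are not needed. \<open>diag_poly_apply_pCons\<close> below is Horner's scheme in terms of \<open>H\<close>.\<close>

definition diag_poly_apply ::
  "complex^'n^'n \<Rightarrow> ('n \<Rightarrow> complex) \<Rightarrow> complex poly \<Rightarrow> complex^'n \<Rightarrow> complex^'n" where
  "diag_poly_apply Y \<sigma> q u = Y *v (\<chi> i. poly q (\<sigma> i) * (matrix_inv Y *v u) $ i)"

lemma diag_poly_apply_0: "diag_poly_apply Y \<sigma> 0 u = 0"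
  by (simp add: diag_poly_apply_def vec_eq_iff matrix_vector_mult_def)

lemma diag_matrix_mult_vec: "diag_matrix \<sigma> *v u = (\<chi> i. \<sigma> i * u $ i)"
  by (simp add: diag_matrix_def matrix_vector_mult_def vec_eq_iff if_distrib if_distribR
      cong: if_cong)

lemma diag_poly_apply_pCons:
  assumes "invertible Y" and "matrix_inv Y ** H ** Y = diag_matrix \<sigma>"
  shows "diag_poly_apply Y \<sigma> (pCons a q) u = a *s u + H *v diag_poly_apply Y \<sigma> q u"
proof -
  let ?c = "matrix_inv Y *v u"
  have YY: "Y ** matrix_inv Y = mat 1"
    using someI_ex[OF assms(1)[unfolded invertible_def]] by (simp add: matrix_inv_def)
  then have HY: "Y ** diag_matrix \<sigma> = H ** Y"
    by (simp add: assms(2)[symmetric] matrix_mul_assoc)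
  have "(\<chi> i. poly (pCons a q) (\<sigma> i) * ?c $ i) =
      a *s ?c + diag_matrix \<sigma> *v (\<chi> i. poly q (\<sigma> i) * ?c $ i)"
    by (simp add: diag_matrix_mult_vec vec_eq_iff algebra_simps)
  then show ?thesis
    by (simp add: diag_poly_apply_def matrix_vector_right_distrib vector_scalar_commute YY
        matrix_vector_mul_assoc HY)
qed

lemma norm_diag_poly_apply_le:
  fixes \<sigma> :: "'n::finite \<Rightarrow> complex"
  shows "norm (diag_poly_apply Y \<sigma> p u) \<le>
    cond2 Y * (MAX i\<in>UNIV. cmod (poly p (\<sigma> i))) * norm u"
proof -
  let ?c = "matrix_inv Y *v u"
  define E where "E = (MAX i\<in>UNIV. cmod (poly p (\<sigma> i)))"
  have E: "cmod (poly p (\<sigma> i)) \<le> E" for i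
    unfolding E_def by (rule Max_ge) auto
  then have E0: "0 \<le> E" by (meson norm_ge_zero order_trans)
  have on: "norm (B *v z) \<le> onorm ((*v) B) * norm z" for B :: "complex^'n^'n" and z
    by (rule onorm) (rule matrix_vector_mul_bounded_linear)
  have on0: "0 \<le> onorm ((*v) B)" for B :: "complex^'n^'n"
    by (rule onorm_pos_le) (rule matrix_vector_mul_bounded_linear)
  have "norm (\<chi> i. poly p (\<sigma> i) * ?c $ i) \<le> L2_set (\<lambda>i. E * norm (?c $ i)) UNIV"
    unfolding norm_vec_def by (rule L2_set_mono) (auto simp: norm_mult intro: mult_right_mono E)
  also have "\<dots> = E * norm ?c"
    unfolding norm_vec_def by (simp add: L2_set_right_distrib E0)
  also have "\<dots> \<le> E * (onorm ((*v) (matrix_inv Y)) * norm u)"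
    by (rule mult_left_mono[OF on E0])
  finally have "norm (\<chi> i. poly p (\<sigma> i) * ?c $ i) \<le> E * (onorm ((*v) (matrix_inv Y)) * norm u)" .
  then have "norm (diag_poly_apply Y \<sigma> p u) \<le>
      onorm ((*v) Y) * (E * (onorm ((*v) (matrix_inv Y)) * norm u))"
    unfolding diag_poly_apply_def by (rule order_trans[OF on mult_left_mono[OF _ on0]])
  then show ?thesis by (simp add: cond2_def E_def mult_ac)
qed

text \<open>A Hessenberg matrix extends the support of a vector by at most one place, so \<open>q(H) e\<^sub>1\<close> is
  supported on the first \<open>degree q + 1\<close> entries.\<close>

lemma diag_poly_apply_supported:
  assumes diag: "invertible Y" "matrix_inv Y ** H ** Y = diag_matrix \<sigma>"
    and hess: "\<And>i j. idx j + 1 < idx i \<Longrightarrow> H $ i $ j = 0"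
    and "idx i1 = (1::nat)"
    and "degree q < m" "m < idx i"
  shows "diag_poly_apply Y \<sigma> q (axis i1 1) $ i = 0"
  using assms(5,6)
proof (induction q arbitrary: m i)
  case 0
  then show ?case by (simp add: diag_poly_apply_0)
next
  case (pCons a q)
  let ?g = "diag_poly_apply Y \<sigma> q (axis i1 1)"
  have "(H *v ?g) $ i = (\<Sum>j\<in>UNIV. H $ i $ j * ?g $ j)"
    by (simp add: matrix_vector_mult_def)
  also have "\<dots> = 0"
  proof (rule sum.neutral, rule ballI)
    fix j
    show "H $ i $ j * ?g $ j = 0"
    proof (cases "idx j + 1 < idx i")
      case True
      then show ?thesis by (simp add: hess)
    next
      case False
      have "?g $ j = 0"
      proof (cases "q = 0")
        case True
        then show ?thesis by (simp add: diag_poly_apply_0)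
      next
        case nz: False
        show ?thesis
          by (rule pCons.IH[of "m - 1"]) (use nz pCons.prems False in auto)
      qed
      then show ?thesis by simp
    qed
  qed
  moreover have "i \<noteq> i1" using pCons.prems assms(4) by auto
  ultimately show ?case
    by (simp add: diag_poly_apply_pCons[OF diag] axis_def)
qed

section \<open>The residual bound\<close>

text \<open>The coefficient vector belonging to \<open>p\<close> is \<open>- \<beta> Re (q(H) e\<^sub>1)\<close>, where \<open>p(t) = 1 + t q(t)\<close>.\<close>

lemma fgmres_lsq_poly_le:
  fixes A :: "real^'n^'n" and \<sigma> :: "'n \<Rightarrow> complex"
  assumes r0: "r0 \<noteq> 0"
    and idx: "bij_betw idx UNIV {1..CARD('n)}"
    and nb: "fgmres_no_breakdown A M r0"
    and diag: "invertible Y" "matrix_inv Y ** fgmres_H idx A M r0 ** Y = diag_matrix \<sigma>"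
    and m: "m \<in> {1..CARD('n)}"
    and p: "degree p \<le> m" "poly p 0 = 1"
  shows "\<exists>y. fgmres_lsq A M r0 m y \<le>
    cond2 Y * (MAX i\<in>UNIV. cmod (poly p (\<sigma> i))) * norm r0"
proof -
  let ?n = "CARD('n)" and ?h = "fgmres_h A M r0" and ?\<beta> = "norm r0"
  define H where "H = fgmres_H idx A M r0"
  \<comment> \<open>the index of the first unit vector\<close>
  define i1 where "i1 = inv_into UNIV idx 1"
  have i1: "idx i1 = 1"
    using idx bij_betw_inv_into_right[OF idx, of 1] by (simp add: i1_def Suc_leI)
  have inj: "idx i = idx j \<longleftrightarrow> i = j" for i j
    using idx by (auto simp: bij_betw_def inj_on_def)
  obtain q where pq: "p = pCons 1 q"
    using p(2) by (cases p) auto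
  have q: "degree q < m"
    using p(1) m by (cases "q = 0") (auto simp: pq)
  define g where "g = diag_poly_apply Y \<sigma> q (axis i1 1)"
  define f where "f = diag_poly_apply Y \<sigma> p (axis i1 1)"
  define y where "y k = - ?\<beta> * Re (g $ inv_into UNIV idx k)" for k
  have inv_idx: "inv_into UNIV idx (idx i) = i" for i
    using idx by (simp add: bij_betw_def)
  have g_supp: "g $ i = 0" if "m < idx i" for i
    unfolding g_def
    by (rule diag_poly_apply_supported[OF diag])
      (use that q i1 in \<open>auto simp: fgmres_H_def fgmres_h_zero\<close>)
  have f: "f = axis i1 1 + H *v g"
    using diag_poly_apply_pCons[OF diag, of 1 q "axis i1 1"]
    by (simp add: f_def g_def H_def pq)
  \<comment> \<open>row \<open>i\<close> of \<open>\<beta> e\<^sub>1 - H y\<close>, for the extended matrix\<close>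
  define \<rho> where "\<rho> i = (if i = 1 then ?\<beta> else 0) - (\<Sum>j=1..m. ?h i j * y j)" for i
  have \<rho>_last: "\<rho> (?n + 1) = 0"
  proof -
    have "(\<Sum>j=1..m. ?h (?n + 1) j * y j) = 0"
      by (rule sum.neutral) (use fgmres_h_completion[OF r0 nb] m in auto)
    then show ?thesis by (simp add: \<rho>_def)
  qed
  \<comment> \<open>Both sides are the real part of an entry of \<open>\<beta> (e\<^sub>1 + H g)\<close>, because \<open>H\<close> is real; the support of
    \<open>g\<close> allows the product to stop after \<open>m\<close> columns.\<close>
  have \<rho>_idx: "\<rho> (idx i) = ?\<beta> * Re (f $ i)" for i
  proof -
    have "(\<Sum>j=1..m. ?h (idx i) j * y j) = (\<Sum>j=1..?n. ?h (idx i) j * y j)"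
    proof (rule sum.mono_neutral_left)
      show "\<forall>j\<in>{1..?n} - {1..m}. ?h (idx i) j * y j = 0"
      proof
        fix j assume j: "j \<in> {1..?n} - {1..m}"
        then have "idx (inv_into UNIV idx j) = j"
          using bij_betw_inv_into_right[OF idx, of j] by simp
        then show "?h (idx i) j * y j = 0"
          using j g_supp[of "inv_into UNIV idx j"] by (auto simp: y_def)
      qed
    qed (use m in auto)
    also have "\<dots> = (\<Sum>j\<in>UNIV. ?h (idx i) (idx j) * y (idx j))"
      by (rule sum.reindex_bij_betw[OF idx, symmetric])
    also have "\<dots> = - ?\<beta> * Re ((H *v g) $ i)"
      by (simp add: y_def inv_idx H_def fgmres_H_def matrix_vector_mult_def sum_distrib_left
          sum_negf mult_ac)
    finally show ?thesis
      using inj[of i i1] by (auto simp: \<rho>_def f i1 axis_def algebra_simps)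
  qed
  have "fgmres_lsq A M r0 m y = L2_set \<rho> {1..m+1}"
    unfolding fgmres_lsq_def \<rho>_def ..
  also have "\<dots> \<le> L2_set \<rho> {1..?n+1}"
    unfolding L2_set_def by (intro real_sqrt_le_mono sum_mono2) (use m in auto)
  also have "\<dots> = L2_set \<rho> {1..?n}"
    using \<rho>_last by (simp add: L2_set_def)
  also have "\<dots> = L2_set (\<lambda>i. \<rho> (idx i)) UNIV"
    unfolding L2_set_def by (simp only: sum.reindex_bij_betw[OF idx, of "\<lambda>i. (\<rho> i)\<^sup>2"])
  also have "\<dots> \<le> L2_set (\<lambda>i. norm (?\<beta> *\<^sub>R f $ i)) UNIV"
  proof -
    have "(?\<beta> * Re z)\<^sup>2 \<le> (?\<beta> * cmod z)\<^sup>2" for z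
      by (rule power2_le_iff_abs_le[THEN iffD2]) (auto simp: abs_mult abs_Re_le_cmod mult_left_mono)
    then show ?thesis
      unfolding L2_set_def by (intro real_sqrt_le_mono sum_mono) (simp add: \<rho>_idx)
  qed
  also have "\<dots> = ?\<beta> * norm f"
    unfolding norm_vec_def by (simp add: L2_set_right_distrib)
  also have "\<dots> \<le> ?\<beta> * (cond2 Y * (MAX i\<in>UNIV. cmod (poly p (\<sigma> i))) * 1)"
    using norm_diag_poly_apply_le[of Y \<sigma> p "axis i1 1"]
    by (intro mult_left_mono) (simp_all add: f_def)
  finally show ?thesis by (intro exI[of _ y]) (simp add: mult_ac)
qed

theorem corollary2:
  fixes A :: "real^'n^'n"
    and b x0 :: "real^'n"
    and M :: "real^'n \<Rightarrow> real^'n"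
    and idx :: "'n \<Rightarrow> nat"
    and Y :: "complex^'n^'n"
    and \<sigma> :: "'n \<Rightarrow> complex"
    and x :: "nat \<Rightarrow> real^'n"
  assumes "b - A *v x0 \<noteq> 0"
    and "bij_betw idx UNIV {1..CARD('n)}"
    and "fgmres_no_breakdown A M (b - A *v x0)"
    and "invertible Y"
    and "matrix_inv Y ** fgmres_H idx A M (b - A *v x0) ** Y = diag_matrix \<sigma>"
    and "\<forall>m\<in>{1..CARD('n)}. fgmres_iterate A b M x0 m (x m)"
  shows "\<forall>m\<in>{1..CARD('n)}. norm (b - A *v x m) \<le> cond2 Y * poly_eps m \<sigma> * norm (b - A *v x0)"
proof
  fix m assume m: "m \<in> {1..CARD('n)}"
  define r0 where "r0 = b - A *v x0"
  obtain y where min: "\<And>y'. fgmres_lsq A M r0 m y \<le> fgmres_lsq A M r0 m y'"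
    and x: "x m = x0 + (\<Sum>j=1..m. y j *\<^sub>R fgmres_z A M r0 j)"
    using assms(6) m unfolding fgmres_iterate_def r0_def Let_def by blast
  obtain p where p: "degree p \<le> m" "poly p 0 = 1"
    "poly_eps m \<sigma> = (MAX i\<in>UNIV. cmod (poly p (\<sigma> i)))"
    by (rule poly_eps_attained)
  obtain y' where y': "fgmres_lsq A M r0 m y' \<le> cond2 Y * poly_eps m \<sigma> * norm r0"
    using fgmres_lsq_poly_le[OF assms(1-5) m p(1,2)] by (auto simp: p(3) r0_def)
  have "b - A *v x m = r0 - A *v (\<Sum>j=1..m. y j *\<^sub>R fgmres_z A M r0 j)"
    by (simp add: x r0_def matrix_vector_right_distrib)
  then have "norm (b - A *v x m) \<le> fgmres_lsq A M r0 m y"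
    by (simp only: norm_residual_le_lsq)
  also have "\<dots> \<le> fgmres_lsq A M r0 m y'" by (rule min)
  also note y'
  finally show "norm (b - A *v x m) \<le> cond2 Y * poly_eps m \<sigma> * norm (b - A *v x0)"
    by (simp add: r0_def)
qed

end
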